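(* Let $(X,d_X,\leq_{P_1})$ and $(Y,d_Y,\leq_{P_2})$ be two partially ordered complete metric spaces. Let $F:X\times Y\rightarrow X$ and $G:Y\times X\rightarrow Y$ be two continuous functions having the mixed monotone property. Assume that there exist non-negative real numbers $a,b,c$ with $2b+c<1$ and $2a+c<1$ satisfying $$d_X(F(x,y),F(u,v))\leq a\, d_X(x,F(u,v))+ b\, d_X(u, F(x,y))+c\, d_X(x,u)\quad \text{for all } x,u\in X,\ y,v\in Y \text{ with } x\geq_{P_1}u,\ y\leq_{P_2}v,$$ $$d_Y(G(y,x),G(v,u))\leq a\, d_Y(y,G(v,u))+ b\, d_Y(v,G(y,x))+c\, d_Y(y,v)\quad \text{for all } x,u\in X,\ y,v\in Y \text{ with } x\leq_{P_1}u,\ y\geq_{P_2}v.$$ If there exist $x_0\in X$, $y_0\in Y$ satisfying $x_0\leq_{P_1} F(x_0, y_0)$ and $y_0\geq_{P_2} G(y_0, x_0)$, then there exist $x\in X$, $y\in Y$ such that $x=F(x,y)$ and $y=G(y,x)$.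
   Context: A partially ordered complete metric space $(X,d_X,\leq_{P_1})$ is a set $X$ with a metric $d_X$ for which it is complete and a partial order $\leq_{P_1}$ (no compatibility between them is assumed). The product $X\times Y$ carries the metric $d((x,y),(u,v))=d_X(x,u)+d_Y(y,v)$ (similarly for $Y\times X$). The maps $F:X\times Y\to X$ and $G:Y\times X\to Y$ have the mixed monotone property if for all $x\in X$, $y\in Y$: for all $x_1,x_2\in X$, $x_1\leq_{P_1} x_2$ implies $F(x_1,y)\leq_{P_1} F(x_2,y)$ and $G(y,x_1)\geq_{P_2}G(y,x_2)$; and for all $y_1,y_2\in Y$, $y_1\leq_{P_2}y_2$ implies $F(x,y_1)\geq_{P_1}F(x,y_2)$ and $G(y_1,x)\leq_{P_2}G(y_2,x)$. *)

theory Defs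
  imports "HOL-Analysis.Analysis"
begin

text \<open>
  A partially ordered complete metric space is a carrier set with a metric on it and an order
  relation on it, where \<open>(x, x') \<in> P\<close> means that \<open>x\<close> is below \<open>x'\<close>. No compatibility between the
  metric and the order is required.
\<close>

definition po_complete_metric_space ::
    "'a set \<Rightarrow> ('a \<Rightarrow> 'a \<Rightarrow> real) \<Rightarrow> 'a rel \<Rightarrow> bool" where
  "po_complete_metric_space X dX P \<longleftrightarrow>
     Metric_space X dX \<and> Metric_space.mcomplete X dX \<and> partial_order_on X P"

text \<open>The sum metric. The library's \<open>prod_dist\<close> is the Euclidean combination instead.\<close>

definition sum_dist ::
    "('a \<Rightarrow> 'a \<Rightarrow> real) \<Rightarrow> ('b \<Rightarrow> 'b \<Rightarrow> real) \<Rightarrow> 'a \<times> 'b \<Rightarrow> 'a \<times> 'b \<Rightarrow> real" where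
  "sum_dist d1 d2 = (\<lambda>(x, y) (u, v). d1 x u + d2 y v)"

lemma Metric_space_sum_dist:
  assumes "Metric_space X d1" and "Metric_space Y d2"
  shows "Metric_space (X \<times> Y) (sum_dist d1 d2)"
proof -
  interpret X: Metric_space X d1 by (fact assms(1))
  interpret Y: Metric_space Y d2 by (fact assms(2))
  show ?thesis
  proof
    fix p q r :: "'a \<times> 'b"
    show "0 \<le> sum_dist d1 d2 p q"
      by (simp add: sum_dist_def split_beta)
    show "sum_dist d1 d2 p q = sum_dist d1 d2 q p"
      by (simp add: sum_dist_def split_beta X.commute Y.commute)
    show "sum_dist d1 d2 p q = 0 \<longleftrightarrow> p = q" if "p \<in> X \<times> Y" "q \<in> X \<times> Y"
      using that by (auto simp: sum_dist_def add_nonneg_eq_0_iff)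
    show "sum_dist d1 d2 p r \<le> sum_dist d1 d2 p q + sum_dist d1 d2 q r"
      if "p \<in> X \<times> Y" "q \<in> X \<times> Y" "r \<in> X \<times> Y"
      using that X.triangle[of "fst p" "fst q" "fst r"] Y.triangle[of "snd p" "snd q" "snd r"]
      by (auto simp: sum_dist_def)
  qed
qed

definition mixed_monotone ::
    "'a set \<Rightarrow> 'a rel \<Rightarrow> 'b set \<Rightarrow> 'b rel \<Rightarrow> ('a \<times> 'b \<Rightarrow> 'a) \<Rightarrow> ('b \<times> 'a \<Rightarrow> 'b) \<Rightarrow> bool" where
  "mixed_monotone X P1 Y P2 F G \<longleftrightarrow>
     (\<forall>x\<in>X. \<forall>y\<in>Y.
        (\<forall>x1\<in>X. \<forall>x2\<in>X. (x1, x2) \<in> P1 \<longrightarrow>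
           (F (x1, y), F (x2, y)) \<in> P1 \<and> (G (y, x2), G (y, x1)) \<in> P2) \<and>
        (\<forall>y1\<in>Y. \<forall>y2\<in>Y. (y1, y2) \<in> P2 \<longrightarrow>
           (F (x, y2), F (x, y1)) \<in> P1 \<and> (G (y1, x), G (y2, x)) \<in> P2))"

end

(* Iterate (x, y) |-> (F (x, y), G (y, x)) from (x0, y0). Mixed monotonicity makes the first
   coordinates increase and the second ones decrease, so the contractive conditions apply to
   consecutive iterates. One of the two cross terms then vanishes and the triangle inequality
   absorbs the other, so consecutive distances decay geometrically, with ratio (b + c) / (1 - b)
   in X and (a + c) / (1 - a) in Y. The iterates converge, and by continuity the limit is a
   coupled fixed point. *)

theory Submission
  imports Defs
begin

text \<open>Writing each bound on a consecutive distance as a difference of powers of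
  \<open>k\<close> makes the triangle inequality telescope, so the distance between any two terms
  from index \<open>N\<close> on is at most \<open>D * k ^ N\<close>, which tends to 0.\<close>

lemma (in Metric_space) MCauchy_geometric:
  assumes s: "\<And>n. s n \<in> M" and k: "0 \<le> k" "k < 1"
    and step: "\<And>n. d (s (Suc n)) (s (Suc (Suc n))) \<le> k * d (s n) (s (Suc n))"
  shows "MCauchy s"
proof -
  \<comment> \<open>Dividing by \<open>1 - k\<close> gives
    \<open>D * (k ^ n - k ^ Suc n) = k ^ n * d (s 0) (s (Suc 0))\<close>, the usual geometric bound
    in telescoping form.\<close>
  define D where "D = d (s 0) (s (Suc 0)) / (1 - k)"
  have D: "0 \<le> D"
    using k by (simp add: D_def)
  have consec: "d (s n) (s (Suc n)) \<le> D * (k ^ n - k ^ Suc n)" for n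
  proof (induction n)
    case 0
    then show ?case using k by (simp add: D_def)
  next
    case (Suc n)
    have "d (s (Suc n)) (s (Suc (Suc n))) \<le> k * (D * (k ^ n - k ^ Suc n))"
      using step[of n] mult_left_mono[OF Suc k(1)] by linarith
    then show ?case by (simp add: algebra_simps)
  qed
  have tele: "d (s n) (s (n + j)) \<le> D * (k ^ n - k ^ (n + j))" for n j
  proof (induction j)
    case 0
    then show ?case using s by simp
  next
    case (Suc j)
    have "d (s n) (s (n + Suc j)) \<le> d (s n) (s (n + j)) + d (s (n + j)) (s (n + Suc j))"
      using s by (simp add: triangle)
    also have "\<dots> \<le> D * (k ^ n - k ^ (n + j)) + D * (k ^ (n + j) - k ^ Suc (n + j))"
      using Suc consec[of "n + j"] by simp
    finally show ?case by (simp add: algebra_simps)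
  qed
  have bound: "d (s n) (s m) \<le> D * k ^ N" if "N \<le> n" "n \<le> m" for N n m
  proof -
    have "d (s n) (s m) \<le> D * (k ^ n - k ^ m)"
      using tele[of n "m - n"] that by simp
    moreover have "k ^ n - k ^ m \<le> k ^ N"
      using power_decreasing[of N n k] zero_le_power[of k m] k that by linarith
    then have "D * (k ^ n - k ^ m) \<le> D * k ^ N"
      using D by (rule mult_left_mono)
    ultimately show ?thesis by linarith
  qed
  have lim: "(\<lambda>N. D * k ^ N) \<longlonglongrightarrow> 0"
    using k by (intro tendsto_mult_right_zero LIMSEQ_power_zero) simp
  have "\<exists>N. \<forall>n n'. N \<le> n \<longrightarrow> N \<le> n' \<longrightarrow> d (s n) (s n') < e" if e: "e > 0" for e
  proof -
    obtain N where N: "D * k ^ N < e"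
      using order_tendstoD(2)[OF lim e] by (auto simp: eventually_sequentially)
    have "d (s n) (s n') < e" if "N \<le> n" "N \<le> n'" for n n'
      using bound[of N n n'] bound[of N n' n] that N commute[of "s n" "s n'"]
      by (cases "n \<le> n'") auto
    then show ?thesis by blast
  qed
  then show ?thesis
    using s by (auto simp: MCauchy_def)
qed

text \<open>Splitting the two-step distance at \<open>s (Suc n)\<close> produces \<open>q\<close>
  times the left-hand side of \<open>step\<close>. Moving it across leaves the ratio
  \<open>(q + c) / (1 - q)\<close>, which is below 1 because \<open>2 * q + c < 1\<close>.\<close>

lemma (in Metric_space) MCauchy_two_step:
  assumes s: "\<And>n. s n \<in> M" and q: "0 \<le> q" "0 \<le> c" "2 * q + c < 1"
    and step: "\<And>n. d (s (Suc n)) (s (Suc (Suc n)))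
                 \<le> q * d (s n) (s (Suc (Suc n))) + c * d (s n) (s (Suc n))"
  shows "MCauchy s"
proof (rule MCauchy_geometric[where k = "(q + c) / (1 - q)"])
  fix n
  have "q * d (s n) (s (Suc (Suc n)))
      \<le> q * (d (s n) (s (Suc n)) + d (s (Suc n)) (s (Suc (Suc n))))"
    using s q by (intro mult_left_mono triangle)
  then have "(1 - q) * d (s (Suc n)) (s (Suc (Suc n))) \<le> (q + c) * d (s n) (s (Suc n))"
    using step[of n] by (simp add: algebra_simps)
  then show "d (s (Suc n)) (s (Suc (Suc n))) \<le> (q + c) / (1 - q) * d (s n) (s (Suc n))"
    using q by (simp add: field_simps)
qed (use s q in \<open>auto simp: field_simps\<close>)

text \<open>Continuity of \<open>F\<close> and \<open>G\<close> refers to the sum metric, while the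
  iterates converge coordinatewise; this connects the two.\<close>

lemma limitin_sum_dist:
  assumes "Metric_space X d1" and "Metric_space Y d2"
    and f: "limitin (Metric_space.mtopology X d1) f x A"
    and g: "limitin (Metric_space.mtopology Y d2) g y A"
  shows "limitin (Metric_space.mtopology (X \<times> Y) (sum_dist d1 d2)) (\<lambda>n. (f n, g n)) (x, y) A"
proof -
  interpret X: Metric_space X d1 by fact
  interpret Y: Metric_space Y d2 by fact
  interpret XY: Metric_space "X \<times> Y" "sum_dist d1 d2"
    using assms by (intro Metric_space_sum_dist)
  have "((\<lambda>n. d1 (f n) x + d2 (g n) y) \<longlongrightarrow> 0) A"
    using f g by (intro tendsto_add_zero) (auto simp: X.limitin_metric_dist_null
        Y.limitin_metric_dist_null)
  then show ?thesis
    using f g unfolding XY.limitin_metric_dist_null X.limitin_metric_dist_null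
        Y.limitin_metric_dist_null
    by (auto simp: sum_dist_def eventually_conj_iff)
qed

theorem theorem2p10:
  fixes X :: "'a set" and dX :: "'a \<Rightarrow> 'a \<Rightarrow> real" and P1 :: "'a rel"
    and Y :: "'b set" and dY :: "'b \<Rightarrow> 'b \<Rightarrow> real" and P2 :: "'b rel"
    and F :: "'a \<times> 'b \<Rightarrow> 'a" and G :: "'b \<times> 'a \<Rightarrow> 'b"
    and a b c :: real
  assumes "po_complete_metric_space X dX P1"
    and "po_complete_metric_space Y dY P2"
    and "F \<in> X \<times> Y \<rightarrow> X"
    and "G \<in> Y \<times> X \<rightarrow> Y"
    and "continuous_map (Metric_space.mtopology (X \<times> Y) (sum_dist dX dY))
           (Metric_space.mtopology X dX) F"
    and "continuous_map (Metric_space.mtopology (Y \<times> X) (sum_dist dY dX))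
           (Metric_space.mtopology Y dY) G"
    and "mixed_monotone X P1 Y P2 F G"
    and "0 \<le> a" and "0 \<le> b" and "0 \<le> c"
    and "2 * b + c < 1" and "2 * a + c < 1"
    and "\<forall>x\<in>X. \<forall>u\<in>X. \<forall>y\<in>Y. \<forall>v\<in>Y. (u, x) \<in> P1 \<and> (y, v) \<in> P2 \<longrightarrow>
           dX (F (x, y)) (F (u, v))
             \<le> a * dX x (F (u, v)) + b * dX u (F (x, y)) + c * dX x u"
    and "\<forall>x\<in>X. \<forall>u\<in>X. \<forall>y\<in>Y. \<forall>v\<in>Y. (x, u) \<in> P1 \<and> (v, y) \<in> P2 \<longrightarrow>
           dY (G (y, x)) (G (v, u))
             \<le> a * dY y (G (v, u)) + b * dY v (G (y, x)) + c * dY y v"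
    and "\<exists>x0\<in>X. \<exists>y0\<in>Y. (x0, F (x0, y0)) \<in> P1 \<and> (G (y0, x0), y0) \<in> P2"
  shows "\<exists>x\<in>X. \<exists>y\<in>Y. x = F (x, y) \<and> y = G (y, x)"
proof -
  interpret X: Metric_space X dX
    using assms(1) by (simp add: po_complete_metric_space_def)
  interpret Y: Metric_space Y dY
    using assms(2) by (simp add: po_complete_metric_space_def)
  have transP: "trans P1" "trans P2"
    using assms(1,2)
    by (auto simp: po_complete_metric_space_def partial_order_on_def preorder_on_def)
  obtain x0 y0 where x0: "x0 \<in> X" "(x0, F (x0, y0)) \<in> P1"
    and y0: "y0 \<in> Y" "(G (y0, x0), y0) \<in> P2"
    using assms(15) by blast
  \<comment> \<open>The two sequences depend on each other, so the pair is iterated as one map and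
    then projected.\<close>
  define p where "p n = ((\<lambda>(x, y). (F (x, y), G (y, x))) ^^ n) (x0, y0)" for n
  define xs where "xs n = fst (p n)" for n
  define ys where "ys n = snd (p n)" for n
  have xs0: "xs 0 = x0" and ys0: "ys 0 = y0"
    by (simp_all add: xs_def ys_def p_def)
  have xs_Suc: "xs (Suc n) = F (xs n, ys n)" and ys_Suc: "ys (Suc n) = G (ys n, xs n)" for n
    by (simp_all add: xs_def ys_def p_def split_beta)
  have mem: "xs n \<in> X \<and> ys n \<in> Y" for n
    using x0 y0 assms(3,4) by (induction n) (auto simp: xs0 ys0 xs_Suc ys_Suc)
  then have xs_in: "xs n \<in> X" and ys_in: "ys n \<in> Y" for n
    by auto
  have mono: "(xs n, xs (Suc n)) \<in> P1 \<and> (ys (Suc n), ys n) \<in> P2" for n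
  proof (induction n)
    case 0
    then show ?case using x0 y0 by (simp add: xs0 ys0 xs_Suc ys_Suc)
  next
    case (Suc n)
    let ?x = "xs n" and ?x' = "xs (Suc n)" and ?y = "ys n" and ?y' = "ys (Suc n)"
    \<comment> \<open>Mixed monotonicity moves one argument at a time, hence the detour through
      \<open>F (?x', ?y)\<close> and \<open>G (?y, ?x')\<close>.\<close>
    have "(F (?x, ?y), F (?x', ?y)) \<in> P1" "(F (?x', ?y), F (?x', ?y')) \<in> P1"
      "(G (?y', ?x'), G (?y, ?x')) \<in> P2" "(G (?y, ?x'), G (?y, ?x)) \<in> P2"
      using assms(7) Suc xs_in ys_in unfolding mixed_monotone_def by blast+
    then have "(F (?x, ?y), F (?x', ?y')) \<in> P1" "(G (?y', ?x'), G (?y, ?x)) \<in> P2"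
      using transP by (blast dest: transD)+
    then show ?case by (simp only: xs_Suc ys_Suc)
  qed
  have "X.MCauchy xs"
  proof (rule X.MCauchy_two_step[OF xs_in assms(9,10,11)])
    fix n
    \<comment> \<open>The order hypotheses force the later iterate into the role of
      \<open>(x, y)\<close>. Then \<open>F (u, v)\<close> is \<open>x\<close> itself, so the
      \<open>a\<close> term is zero and \<open>b\<close> survives.\<close>
    have "dX (xs (Suc (Suc n))) (xs (Suc n))
        \<le> a * dX (xs (Suc n)) (xs (Suc n)) + b * dX (xs n) (xs (Suc (Suc n)))
          + c * dX (xs (Suc n)) (xs n)"
      using assms(13) mono[of n] xs_in ys_in by (metis xs_Suc)
    then show "dX (xs (Suc n)) (xs (Suc (Suc n)))
        \<le> b * dX (xs n) (xs (Suc (Suc n))) + c * dX (xs n) (xs (Suc n))"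
      using xs_in by (simp add: X.commute)
  qed
  moreover have "Y.MCauchy ys"
  proof (rule Y.MCauchy_two_step[OF ys_in assms(8,10,12)])
    fix n
    \<comment> \<open>Here the roles are reversed: \<open>(x, y)\<close> is the earlier iterate,
      \<open>G (y, x)\<close> equals \<open>v\<close>, and the \<open>a\<close> term survives
      instead. This is where \<open>2 * a + c < 1\<close> enters.\<close>
    have "dY (ys (Suc n)) (ys (Suc (Suc n)))
        \<le> a * dY (ys n) (ys (Suc (Suc n))) + b * dY (ys (Suc n)) (ys (Suc n))
          + c * dY (ys n) (ys (Suc n))"
      using assms(14) mono[of n] xs_in ys_in by (metis ys_Suc)
    then show "dY (ys (Suc n)) (ys (Suc (Suc n)))
        \<le> a * dY (ys n) (ys (Suc (Suc n))) + c * dY (ys n) (ys (Suc n))"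
      using ys_in by simp
  qed
  ultimately obtain x y where x: "limitin X.mtopology xs x sequentially"
    and y: "limitin Y.mtopology ys y sequentially"
    using assms(1,2) unfolding po_complete_metric_space_def X.mcomplete_def Y.mcomplete_def
    by blast
  have "limitin X.mtopology (F \<circ> (\<lambda>n. (xs n, ys n))) (F (x, y)) sequentially"
    by (intro continuous_map_limit[OF assms(5)] limitin_sum_dist X.Metric_space_axioms
        Y.Metric_space_axioms x y)
  \<comment> \<open>The image sequence is the shifted sequence \<open>xs\<close>, which still tends
    to \<open>x\<close>; uniqueness of limits identifies \<open>x\<close> with
    \<open>F (x, y)\<close>.\<close>
  moreover have "F \<circ> (\<lambda>n. (xs n, ys n)) = (\<lambda>n. xs (n + 1))"
    by (auto simp: xs_Suc)
  ultimately have "x = F (x, y)"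
    using limitin_sequentially_offset[OF x, of 1] X.limitin_metric_unique
      trivial_limit_sequentially by metis
  have "limitin Y.mtopology (G \<circ> (\<lambda>n. (ys n, xs n))) (G (y, x)) sequentially"
    by (intro continuous_map_limit[OF assms(6)] limitin_sum_dist X.Metric_space_axioms
        Y.Metric_space_axioms x y)
  moreover have "G \<circ> (\<lambda>n. (ys n, xs n)) = (\<lambda>n. ys (n + 1))"
    by (auto simp: ys_Suc)
  ultimately have "y = G (y, x)"
    using limitin_sequentially_offset[OF y, of 1] Y.limitin_metric_unique
      trivial_limit_sequentially by metis
  have "x \<in> X" "y \<in> Y"
    using x y by (auto simp: X.limitin_metric Y.limitin_metric)
  with \<open>x = F (x, y)\<close> \<open>y = G (y, x)\<close> show ?thesis by blast
qed

end
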